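(* Suppose $\ker\begin{bmatrix}X_-R_-^\top\\ U_-R_-^\top\end{bmatrix}^\top=\{0\}$, and let $\sigma_{(U_-,X)}^1,\dots,\sigma_{(U_-,X)}^L\in\mathbb{R}^{n\times(n+m)}$ be the vertices of the convex polytope $\Sigma_{(U_-,X)}^R$. The data $(U_-,X)$ are informative for quadratic stabilization by state feedback if and only if there exist $K\in\mathbb{R}^{m\times n}$ and a symmetric $P\in\mathbb{R}^{n\times n}$ such that $P\succ0$ and $$\begin{bmatrix}I\\ K\end{bmatrix}^\top(\sigma_{(U_-,X)}^i)^\top P\,\sigma_{(U_-,X)}^i\begin{bmatrix}I\\ K\end{bmatrix}-P\prec0,\qquad i=1,\dots,L.$$
   Context: Let $n,m,M,N\ge 1$ be integers. State data $x(0),\dots,x(N)\in\mathbb{R}^n$ and input data $u(0),\dots,u(N-1)\in\mathbb{R}^m$ are collected in $X=[x(0)\ \cdots\ x(N)]$, $X_+=[x(1)\ \cdots\ x(N)]$, $X_-=[x(0)\ \cdots\ x(N-1)]$, $U_-=[u(0)\ \cdots\ u(N-1)]$. An instrumental signal matrix $R_-\in\mathbb{R}^{M\times N}$ and bounds $C_l,C_u\in\mathbb{R}^{n\times M}$ are given. Inequalities $\le$ between matrices are entry-wise; $\succ,\prec$ refer to positive/negative definiteness of symmetric matrices. The data are generated by a true system $(A_0,B_0)$, i.e. $X_+=A_0X_-+B_0U_-+E_-^0$ for some unknown $E_-^0\in\mathcal{E}_R:=\{E\in\mathbb{R}^{n\times N}\mid C_l\le\tfrac{1}{\sqrt N}ER_-^\top\le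 C_u\}$. The (hence non-empty) set of feasible systems is $$\Sigma_{(U_-,X)}^R:=\{(A,B)\in\mathbb{R}^{n\times n}\times\mathbb{R}^{n\times m}\mid \exists E_-\in\mathcal{E}_R:\ X_+=AX_-+BU_-+E_-\}.$$ A pair $(A,B)$ is identified with $[A\ \ B]\in\mathbb{R}^{n\times(n+m)}$. Under the kernel condition of the claim, $\Sigma_{(U_-,X)}^R$ is a bounded polyhedron, so it is the convex hull of its finitely many vertices $\sigma_{(U_-,X)}^1,\dots,\sigma_{(U_-,X)}^L$. The data $(U_-,X)$ are informative for quadratic stabilization by state feedback if there exist $K\in\mathbb{R}^{m\times n}$ and $P\succ0$ such that $(A+BK)P(A+BK)^\top-P\prec0$ for all $(A,B)\in\Sigma_{(U_-,X)}^R$. *)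

theory Defs
  imports "HOL-Analysis.Analysis"
begin

text \<open>
  All sizes are finite index types: \<open>'n\<close> for states, \<open>'m\<close> for inputs, \<open>'M\<close> for instrumental
  signals, \<open>'N\<close> for the \<open>N\<close> samples. The type \<open>'N\<close> is linearly ordered, so that its elements are
  the sample times \<open>0, \<dots>, N - 1\<close> in increasing order (any numeral type is an instance).
  Signals are functions on \<^typ>\<open>nat\<close>; only \<open>x 0, \<dots>, x N\<close> and \<open>u 0, \<dots>, u (N - 1)\<close> are ever used.
\<close>

definition sample_time :: "'N::{finite,linorder} \<Rightarrow> nat" where
  "sample_time j = card {..<j}"

definition X_plus :: "(nat \<Rightarrow> real^'n) \<Rightarrow> real^'N::{finite,linorder}^'n" where
  "X_plus x = (\<chi> i j. x (Suc (sample_time j)) $ i)"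

definition X_minus :: "(nat \<Rightarrow> real^'n) \<Rightarrow> real^'N::{finite,linorder}^'n" where
  "X_minus x = (\<chi> i j. x (sample_time j) $ i)"

definition U_minus :: "(nat \<Rightarrow> real^'m) \<Rightarrow> real^'N::{finite,linorder}^'m" where
  "U_minus u = (\<chi> i j. u (sample_time j) $ i)"

text \<open>Block matrices \<open>[A B]\<close> and \<open>[A; B]\<close>.\<close>

definition hcat :: "real^'a^'r \<Rightarrow> real^'b^'r \<Rightarrow> real^('a + 'b)^'r" where
  "hcat A B = (\<chi> i j. case j of Inl k \<Rightarrow> A $ i $ k | Inr k \<Rightarrow> B $ i $ k)"

definition vcat :: "real^'c^'a \<Rightarrow> real^'c^'b \<Rightarrow> real^'c^('a + 'b)" where
  "vcat A B = (\<chi> i. case i of Inl k \<Rightarrow> A $ k | Inr k \<Rightarrow> B $ k)"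

definition kernel :: "real^'c^'r \<Rightarrow> (real^'c) set" where
  "kernel A = {v. A *v v = 0}"

definition pos_def :: "real^'n^'n \<Rightarrow> bool" where
  "pos_def P \<longleftrightarrow> transpose P = P \<and> (\<forall>v. v \<noteq> 0 \<longrightarrow> v \<bullet> (P *v v) > 0)"

definition neg_def :: "real^'n^'n \<Rightarrow> bool" where
  "neg_def P \<longleftrightarrow> transpose P = P \<and> (\<forall>v. v \<noteq> 0 \<longrightarrow> v \<bullet> (P *v v) < 0)"

text \<open>The library order \<open>\<le>\<close> on \<open>real^'M^'n\<close> is the entry-wise one.\<close>

definition noise_set ::
    "real^'N^'M \<Rightarrow> real^'M^'n \<Rightarrow> real^'M^'n \<Rightarrow> (real^'N::finite^'n) set" where
  "noise_set R Cl Cu =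
     {E. Cl \<le> (1 / sqrt (real CARD('N))) *\<^sub>R (E ** transpose R) \<and>
         (1 / sqrt (real CARD('N))) *\<^sub>R (E ** transpose R) \<le> Cu}"

definition feasible_systems ::
    "real^'N::{finite,linorder}^'M \<Rightarrow> real^'M^'n \<Rightarrow> real^'M^'n \<Rightarrow>
     (nat \<Rightarrow> real^'m) \<Rightarrow> (nat \<Rightarrow> real^'n) \<Rightarrow> ((real^'n^'n) \<times> (real^'m^'n)) set" where
  "feasible_systems R Cl Cu u x =
     {(A, B). \<exists>E \<in> noise_set R Cl Cu.
        X_plus x = A ** X_minus x + B ** U_minus u + E}"

definition informative_quadratic_stabilization ::
    "real^'N::{finite,linorder}^'M \<Rightarrow> real^'M^'n \<Rightarrow> real^'M^'n \<Rightarrow>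
     (nat \<Rightarrow> real^'m) \<Rightarrow> (nat \<Rightarrow> real^'n) \<Rightarrow> bool" where
  "informative_quadratic_stabilization R Cl Cu u x \<longleftrightarrow>
     (\<exists>(K :: real^'n^'m) (P :: real^'n^'n). pos_def P \<and>
        (\<forall>(A, B) \<in> feasible_systems R Cl Cu u x.
           neg_def ((A + B ** K) ** P ** transpose (A + B ** K) - P)))"

definition vertices :: "'a::real_vector set \<Rightarrow> 'a set" where
  "vertices S = {v. v extreme_point_of S}"

text \<open>The vertices of the feasible set, a pair \<open>(A, B)\<close> being identified with \<open>[A B]\<close>.\<close>

definition feasible_vertices ::
    "real^'N::{finite,linorder}^'M \<Rightarrow> real^'M^'n \<Rightarrow> real^'M^'n \<Rightarrow>
     (nat \<Rightarrow> real^'m) \<Rightarrow> (nat \<Rightarrow> real^'n) \<Rightarrow> (real^('n + 'm)^'n) set" where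
  "feasible_vertices R Cl Cu u x =
     vertices ((\<lambda>(A, B). hcat A B) ` feasible_systems R Cl Cu u x)"

end

theory Submission
  imports Defs
begin

text \<open>
  Write \<open>F = \<sigma> [I; K] = A + B K\<close> for the closed loop of \<open>\<sigma> = [A B]\<close>. Two facts make the equivalence
  work.

  Convexity: the condition \<open>F\<^sup>T P F \<prec> P\<close> says that \<open>F v\<close> lies in the convex set
  \<open>{w. w\<^sup>T P w < v\<^sup>T P v}\<close> for every \<open>v \<noteq> 0\<close>. Since \<open>F v\<close> is linear in \<open>\<sigma>\<close>, the \<open>\<sigma>\<close> with this property form
  a convex set (\<open>convex_contracting_systems\<close>), and so the condition passes from the vertices of a
  polytope to all of it. The feasible set is such a polytope: it consists of the \<open>\<sigma>\<close> for which
  the affine function \<open>(X\<^sub>+ R\<^sup>T - \<sigma> W) / \<surd>N\<close>, with \<open>W = [X\<^sub>- R\<^sup>T; U\<^sub>- R\<^sup>T]\<close>, takes values in the box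
  \<open>[C\<^sub>l, C\<^sub>u]\<close>, and the kernel condition gives \<open>W\<close> a right inverse, which bounds \<open>\<sigma>\<close> in terms of
  \<open>\<sigma> W\<close> (\<open>compact_affine_box_preimage\<close>). By Minkowski's theorem it is the convex hull of its vertices.

  Duality: informativity is stated with \<open>F P F\<^sup>T \<prec> P\<close>, the vertex condition with \<open>F\<^sup>T P F \<prec> P\<close>. These
  are exchanged by \<open>P \<mapsto> P\<inverse>\<close> (\<open>neg_def_Stein_dual\<close>), simultaneously for all \<open>F\<close>, so that one common \<open>P\<close>
  for all feasible systems on one side gives one common \<open>P\<inverse>\<close> on the other.
\<close>

section \<open>Quadratic forms and duality of the discrete Lyapunov inequality\<close>

lemma inner_transpose_mult: "(transpose A *v v) \<bullet> w = v \<bullet> (A *v w)" for A :: "real^'a^'b"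
  by (simp add: dot_lmul_matrix)

lemma inner_symmetric_mult:
  fixes P :: "real^'n^'n"
  assumes "transpose P = P"
  shows "v \<bullet> (P *v w) = w \<bullet> (P *v v)"
  using inner_transpose_mult[of P v w] assms by (simp add: inner_commute)

lemma matrix_mult_diff_rdistrib: "(A - B) ** C = A ** C - B ** C" for A B :: "real^'b^'a"
  by (simp add: matrix_matrix_mult_def vec_eq_iff sum_subtractf algebra_simps)

lemma transpose_diff: "transpose (A - B) = transpose A - transpose B" for A B :: "real^'b^'a"
  by (simp add: transpose_def vec_eq_iff)

lemma neg_def_congruence_iff:
  fixes F :: "real^'k^'n" and P :: "real^'n^'n" and Q :: "real^'k^'k"
  assumes "transpose P = P" "transpose Q = Q"
  shows "neg_def (transpose F ** P ** F - Q) \<longleftrightarrow>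
    (\<forall>v. v \<noteq> 0 \<longrightarrow> (F *v v) \<bullet> (P *v (F *v v)) < v \<bullet> (Q *v v))"
proof -
  have "v \<bullet> ((transpose F ** P ** F - Q) *v v) = (F *v v) \<bullet> (P *v (F *v v)) - v \<bullet> (Q *v v)" for v
    using inner_transpose_mult[of "transpose F" v "P *v (F *v v)"]
    by (simp add: matrix_vector_mult_diff_rdistrib inner_diff_right
        matrix_vector_mul_assoc [symmetric] del: transpose_matrix_vector)
  then show ?thesis
    using assms by (simp add: neg_def_def transpose_diff matrix_transpose_mul matrix_mul_assoc)
qed

lemma pos_def_nonneg: "pos_def P \<Longrightarrow> 0 \<le> v \<bullet> (P *v v)"
  by (cases "v = 0") (auto simp: pos_def_def less_imp_le)

lemma pos_def_has_pos_def_inverse: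
  fixes P :: "real^'n^'n"
  assumes P: "pos_def P"
  obtains Q where "P ** Q = mat 1" "Q ** P = mat 1" "pos_def Q"
proof -
  have sym: "transpose P = P"
    using P by (simp add: pos_def_def)
  have "v = 0" if "P *v v = 0" for v
    using P that by (metis inner_zero_right less_irrefl pos_def_def)
  then obtain Q where QP: "Q ** P = mat 1"
    using matrix_left_invertible_ker by blast
  then have PQ: "P ** Q = mat 1"
    by (simp add: matrix_left_right_inverse)
  have "transpose Q ** P = mat 1"
    using arg_cong[OF PQ, of transpose] sym by (simp add: matrix_transpose_mul)
  then have symQ: "transpose Q = Q"
    by (metis PQ matrix_mul_assoc matrix_mul_lid matrix_mul_rid)
  have PQv: "P *v (Q *v v) = v" for v
    by (simp add: matrix_vector_mul_assoc PQ)
  have "0 < v \<bullet> (Q *v v)" if "v \<noteq> 0" for v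
  proof -
    have "Q *v v \<noteq> 0"
      using that PQv[of v] by auto
    then have "0 < (Q *v v) \<bullet> (P *v (Q *v v))"
      using P by (simp add: pos_def_def)
    then show ?thesis
      by (simp add: PQv inner_commute)
  qed
  then show thesis
    using that PQ QP symQ by (auto simp: pos_def_def)
qed

text \<open>
  Given \<open>w\<close>, put \<open>z = Q F w\<close> and \<open>s = z\<^sup>T P z = (F w)\<^sup>T Q (F w) = z\<^sup>T F w\<close>. Expanding
  \<open>0 \<le> (F\<^sup>T z - Q w)\<^sup>T P (F\<^sup>T z - Q w)\<close> gives \<open>2 s \<le> z\<^sup>T F P F\<^sup>T z + w\<^sup>T Q w\<close>, and the first term on the
  right is less than \<open>s\<close> by assumption (unless \<open>z = 0\<close>, where \<open>s = 0\<close>).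
\<close>

lemma neg_def_Stein_dual:
  fixes F P Q :: "real^'n^'n"
  assumes P: "pos_def P" and Q: "pos_def Q" and PQ: "P ** Q = mat 1"
    and stable: "neg_def (F ** P ** transpose F - P)"
  shows "neg_def (transpose F ** Q ** F - Q)"
proof -
  have symP: "transpose P = P" and symQ: "transpose Q = Q"
    using P Q by (auto simp: pos_def_def)
  have PQv: "P *v (Q *v v) = v" for v
    by (simp add: matrix_vector_mul_assoc PQ)
  have decrease: "(transpose F *v z) \<bullet> (P *v (transpose F *v z)) < z \<bullet> (P *v z)" if "z \<noteq> 0" for z
    using stable that neg_def_congruence_iff[OF symP symP, of "transpose F"] by simp
  have "(F *v w) \<bullet> (Q *v (F *v w)) < w \<bullet> (Q *v w)" if "w \<noteq> 0" for w
  proof (cases "Q *v (F *v w) = 0")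
    case True
    then show ?thesis
      using Q that by (simp add: pos_def_def)
  next
    case False
    define z where "z = Q *v (F *v w)"
    define y where "y = transpose F *v z"
    have s: "z \<bullet> (P *v z) = (F *v w) \<bullet> z"
      by (simp add: z_def PQv inner_commute)
    have yw: "y \<bullet> w = (F *v w) \<bullet> z"
      unfolding y_def inner_transpose_mult by (simp add: inner_commute)
    have "0 \<le> (y - Q *v w) \<bullet> (P *v (y - Q *v w))"
      by (rule pos_def_nonneg[OF P])
    also have "\<dots> = y \<bullet> (P *v y) - 2 * (y \<bullet> w) + w \<bullet> (Q *v w)"
      using inner_symmetric_mult[OF symP, of "Q *v w" y]
      by (simp add: matrix_vector_mult_diff_distrib inner_diff_left inner_diff_right PQv
          inner_commute)
    finally have "2 * ((F *v w) \<bullet> z) \<le> y \<bullet> (P *v y) + w \<bullet> (Q *v w)"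
      by (simp add: yw)
    moreover have "y \<bullet> (P *v y) < (F *v w) \<bullet> z"
      using decrease[of z] False s by (simp add: y_def z_def)
    ultimately show ?thesis
      by (simp add: z_def)
  qed
  then show ?thesis
    using neg_def_congruence_iff[OF symQ symQ, of F] by simp
qed

section \<open>Convexity of the vertex condition\<close>

lemma convex_quadratic_sublevel:
  fixes P :: "real^'n^'n"
  assumes P: "pos_def P"
  shows "convex {w. w \<bullet> (P *v w) < c}"
proof -
  have below_chord: "((1 - t) *\<^sub>R a + t *\<^sub>R b) \<bullet> (P *v ((1 - t) *\<^sub>R a + t *\<^sub>R b))
      \<le> (1 - t) * (a \<bullet> (P *v a)) + t * (b \<bullet> (P *v b))" if t: "0 \<le> t" "t \<le> 1" for t :: real and a b
  proof -
    have "a \<bullet> (P *v b) = b \<bullet> (P *v a)"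
      using P by (intro inner_symmetric_mult) (simp add: pos_def_def)
    then have "(1 - t) * (a \<bullet> (P *v a)) + t * (b \<bullet> (P *v b))
        - ((1 - t) *\<^sub>R a + t *\<^sub>R b) \<bullet> (P *v ((1 - t) *\<^sub>R a + t *\<^sub>R b))
      = t * (1 - t) * ((a - b) \<bullet> (P *v (a - b)))"
      by (simp add: matrix_vector_right_distrib matrix_vector_mult_diff_distrib
          matrix_vector_mult_scaleR inner_add_left inner_add_right inner_diff_left
          inner_diff_right) (simp add: algebra_simps)
    also have "\<dots> \<ge> 0"
      using t pos_def_nonneg[OF P] by simp
    finally show ?thesis
      by simp
  qed
  show ?thesis
    unfolding convex_alt
  proof (intro ballI allI impI, elim conjE, unfold mem_Collect_eq)
    fix a b :: "real^'n" and t :: real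
    assume "a \<bullet> (P *v a) < c" "b \<bullet> (P *v b) < c" and t: "0 \<le> t" "t \<le> 1"
    then have "(1 - t) * (a \<bullet> (P *v a)) + t * (b \<bullet> (P *v b)) < c"
      by (intro convex_bound_lt) auto
    then show "((1 - t) *\<^sub>R a + t *\<^sub>R b) \<bullet> (P *v ((1 - t) *\<^sub>R a + t *\<^sub>R b)) < c"
      using below_chord[OF t, of a b] by linarith
  qed
qed

lemma linear_matrix_mult_left: "linear (\<lambda>S. S ** W)" for W :: "real^'c^'b"
  by (rule linearI)
    (simp_all add: matrix_matrix_mult_def vec_eq_iff sum.distrib sum_distrib_left algebra_simps)

lemma linear_matrix_apply: "linear (\<lambda>S. S *v w)" for w :: "real^'b"
  by (rule linearI)
    (simp_all add: matrix_vector_mult_add_rdistrib scaleR_matrix_vector_assoc)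

lemma convex_contracting_systems:
  fixes T :: "real^'n^'k" and P :: "real^'n^'n"
  assumes P: "pos_def P"
  shows "convex {S :: real^'k^'n. neg_def (transpose (S ** T) ** P ** (S ** T) - P)}"
proof -
  have sym: "transpose P = P"
    using P by (simp add: pos_def_def)
  have "{S :: real^'k^'n. neg_def (transpose (S ** T) ** P ** (S ** T) - P)}
      = (\<Inter>v \<in> - {0}. (\<lambda>S. S *v (T *v v)) -` {w. w \<bullet> (P *v w) < v \<bullet> (P *v v)})"
    by (auto simp: neg_def_congruence_iff[OF sym sym] matrix_vector_mul_assoc)
  moreover have "convex \<dots>"
    by (intro convex_INT convex_linear_vimage linear_matrix_apply convex_quadratic_sublevel[OF P])
  ultimately show ?thesis
    by simp
qed

section \<open>The feasible set as a polytope\<close>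

text \<open>
  A right inverse \<open>V\<close> of \<open>W\<close> recovers \<open>S = (S W) V\<close>, so the preimage is contained in a continuous
  image of the compact box.
\<close>

lemma compact_affine_box_preimage:
  fixes W :: "real^'M^'k" and Y Cl Cu :: "real^'M^'n"
  assumes ker: "kernel (transpose W) = {0}" and c: "c \<noteq> 0"
  shows "compact {S :: real^'k^'n. c *\<^sub>R (Y - S ** W) \<in> {Cl..Cu}}" (is "compact ?T")
proof -
  have cont: "continuous_on A (\<lambda>S. S ** Z)" for Z :: "real^'d^'c" and A :: "(real^'c^'e) set"
    by (rule linear_continuous_on) (simp add: linear_matrix_mult_left linear_linear)
  have "\<forall>v. transpose W *v v = 0 \<longrightarrow> v = 0"
    using ker unfolding kernel_def by blast
  then obtain V' where "V' ** transpose W = mat 1"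
    using matrix_left_invertible_ker by blast
  then have "transpose (V' ** transpose W) = mat 1"
    by simp
  then have WV: "W ** transpose V' = mat 1"
    by (simp add: matrix_transpose_mul)
  have "?T = (\<lambda>S. c *\<^sub>R (Y - S ** W)) -` {Cl..Cu}"
    by auto
  then have "closed ?T"
    by (simp add: closed_vimage continuous_intros cont del: atLeastAtMost_iff)
  moreover have "compact ((\<lambda>D. (Y - (1 / c) *\<^sub>R D) ** transpose V') ` {Cl..Cu})"
  proof (intro compact_continuous_image compact_interval)
    show "continuous_on {Cl..Cu} (\<lambda>D. (Y - (1 / c) *\<^sub>R D) ** transpose V')"
      by (intro continuous_on_compose2[OF cont[of UNIV]] continuous_intros) auto
  qed
  moreover have "?T \<subseteq> (\<lambda>D. (Y - (1 / c) *\<^sub>R D) ** transpose V') ` {Cl..Cu}"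
  proof
    fix S assume "S \<in> ?T"
    moreover have "S = (Y - (1 / c) *\<^sub>R (c *\<^sub>R (Y - S ** W))) ** transpose V'"
      using c by (simp add: matrix_mul_assoc [symmetric] WV)
    ultimately show "S \<in> (\<lambda>D. (Y - (1 / c) *\<^sub>R D) ** transpose V') ` {Cl..Cu}"
      by blast
  qed
  ultimately show ?thesis
    by (metis closed_Int_compact inf.absorb_iff1)
qed

lemma convex_affine_box_preimage:
  fixes W :: "real^'M^'k" and Y Cl Cu :: "real^'M^'n"
  shows "convex {S :: real^'k^'n. c *\<^sub>R (Y - S ** W) \<in> {Cl..Cu}}"
proof -
  have "linear (\<lambda>S :: real^'k^'n. (- c) *\<^sub>R (S ** W))"
    by (intro linear_compose_scale_right linear_matrix_mult_left)
  moreover have "convex {Cl - c *\<^sub>R Y..Cu - c *\<^sub>R Y}"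
    by (rule convex_closed_interval)
  moreover have "{S :: real^'k^'n. c *\<^sub>R (Y - S ** W) \<in> {Cl..Cu}}
      = (\<lambda>S. (- c) *\<^sub>R (S ** W)) -` {Cl - c *\<^sub>R Y..Cu - c *\<^sub>R Y}"
    by (auto simp: algebra_simps)
  ultimately show ?thesis
    by (metis convex_linear_vimage)
qed

lemma hcat_mult_vcat:
  fixes A :: "real^'a^'r" and B :: "real^'b^'r"
  shows "hcat A B ** vcat C D = A ** C + B ** D"
proof -
  have split: "(\<Sum>k\<in>UNIV. f k) = (\<Sum>k\<in>UNIV. f (Inl k)) + (\<Sum>k\<in>UNIV. f (Inr k))"
    for f :: "'a + 'b \<Rightarrow> real"
    by (simp add: UNIV_Plus_UNIV [symmetric] sum.Plus del: UNIV_Plus_UNIV)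
  show ?thesis
    by (simp add: vec_eq_iff matrix_matrix_mult_def hcat_def vcat_def split)
qed

lemma hcat_surj: "\<exists>A B. S = hcat A B"
proof
  show "\<exists>B. S = hcat (\<chi> i j. S $ i $ Inl j) B"
    by (rule exI[of _ "\<chi> i j. S $ i $ Inr j"])
      (auto simp: hcat_def vec_eq_iff split: sum.split)
qed

text \<open>
  The data equation determines the noise \<open>E\<close> from \<open>(A, B)\<close>. This removes the existential quantifier,
  and the bounds on \<open>E R\<^sup>T\<close> become bounds on an affine function of \<open>[A B]\<close>.
\<close>

lemma feasible_systems_affine_box_preimage:
  fixes x :: "nat \<Rightarrow> real^'n" and u :: "nat \<Rightarrow> real^'m"
    and R :: "real^'N::{finite,linorder}^'M"
  shows "(\<lambda>(A, B). hcat A B) ` feasible_systems R Cl Cu u x =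
    {S. (1 / sqrt (real CARD('N))) *\<^sub>R (X_plus x ** transpose R
        - S ** vcat (X_minus x ** transpose R) (U_minus u ** transpose R)) \<in> {Cl..Cu}}"
    (is "_ = {S. ?c *\<^sub>R (?Y - S ** ?W) \<in> _}")
proof -
  have feas: "(A, B) \<in> feasible_systems R Cl Cu u x \<longleftrightarrow> ?c *\<^sub>R (?Y - hcat A B ** ?W) \<in> {Cl..Cu}" for A B
  proof -
    define E :: "real^'N::{finite,linorder}^'n" where "E = X_plus x - (A ** X_minus x + B ** U_minus u)"
    have "(A, B) \<in> feasible_systems R Cl Cu u x \<longleftrightarrow> E \<in> noise_set R Cl Cu"
    proof
      assume "(A, B) \<in> feasible_systems R Cl Cu u x"
      then show "E \<in> noise_set R Cl Cu"
        by (auto simp: feasible_systems_def E_def)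
    next
      assume "E \<in> noise_set R Cl Cu"
      then show "(A, B) \<in> feasible_systems R Cl Cu u x"
        by (auto simp: feasible_systems_def E_def intro!: bexI[of _ E])
    qed
    moreover have "E ** transpose R = ?Y - hcat A B ** ?W"
      by (simp add: E_def hcat_mult_vcat matrix_mult_diff_rdistrib matrix_mul_assoc
          linear_add[OF linear_matrix_mult_left])
    ultimately show ?thesis
      by (simp add: noise_set_def)
  qed
  show ?thesis
  proof (intro set_eqI)
    fix S :: "real^('n + 'm)^'n"
    obtain A B where "S = hcat A B"
      using hcat_surj by blast
    then show "S \<in> (\<lambda>(A, B). hcat A B) ` feasible_systems R Cl Cu u x \<longleftrightarrow>
      S \<in> {S. ?c *\<^sub>R (?Y - S ** ?W) \<in> {Cl..Cu}}"
      using feas by (auto simp del: atLeastAtMost_iff)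
  qed
qed

lemma feasible_systems_eq_hull_vertices:
  assumes ker: "kernel (transpose (vcat (X_minus x ** transpose R) (U_minus u ** transpose R))) = {0}"
  shows "(\<lambda>(A, B). hcat A B) ` feasible_systems R Cl Cu u x
    = convex hull (feasible_vertices R Cl Cu u x)"
  unfolding feasible_vertices_def vertices_def feasible_systems_affine_box_preimage
  by (intro Krein_Milman_Minkowski compact_affine_box_preimage[OF ker] convex_affine_box_preimage) simp

section \<open>The vertex test for quadratic stabilization\<close>

theorem proposition12:
  fixes x :: "nat \<Rightarrow> real^'n" and u :: "nat \<Rightarrow> real^'m"
    and R :: "real^'N::{finite,linorder}^'M"
    and Cl Cu :: "real^'M^'n"
    and A0 :: "real^'n^'n" and B0 :: "real^'m^'n" and E0 :: "real^'N::{finite,linorder}^'n"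
  assumes true_system: "X_plus x = A0 ** X_minus x + B0 ** U_minus u + E0"
    and noise: "E0 \<in> noise_set R Cl Cu"
    and ker: "kernel (transpose (vcat (X_minus x ** transpose R) (U_minus u ** transpose R))) = {0}"
  shows "informative_quadratic_stabilization R Cl Cu u x \<longleftrightarrow>
    (\<exists>(K :: real^'n^'m) (P :: real^'n^'n). transpose P = P \<and> pos_def P \<and>
       (\<forall>\<sigma> \<in> feasible_vertices R Cl Cu u x.
          neg_def (transpose (vcat (mat 1) K) ** transpose \<sigma> ** P ** \<sigma> ** vcat (mat 1) K - P)))"
proof -
  note hull = feasible_systems_eq_hull_vertices[OF ker, of Cl Cu]
  have regroup: "transpose (vcat (mat 1) K) ** transpose S ** P ** S ** vcat (mat 1) K - P
      = transpose (S ** vcat (mat 1) K) ** P ** (S ** vcat (mat 1) K) - P"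
    for S and K :: "real^'n^'m" and P :: "real^'n^'n"
    by (simp add: matrix_transpose_mul matrix_mul_assoc)
  have loop: "hcat A B ** vcat (mat 1) K = A + B ** K" for A :: "real^'n^'n" and B and K :: "real^'n^'m"
    by (simp add: hcat_mult_vcat)
  show ?thesis
    unfolding regroup
  proof
    assume "informative_quadratic_stabilization R Cl Cu u x"
    then obtain K :: "real^'n^'m" and P :: "real^'n^'n" where P: "pos_def P"
      and stable: "\<And>A B. (A, B) \<in> feasible_systems R Cl Cu u x \<Longrightarrow>
        neg_def ((A + B ** K) ** P ** transpose (A + B ** K) - P)"
      unfolding informative_quadratic_stabilization_def by blast
    obtain Q where Q: "P ** Q = mat 1" "pos_def Q"
      using pos_def_has_pos_def_inverse[OF P] by blast
    have "neg_def (transpose (S ** vcat (mat 1) K) ** Q ** (S ** vcat (mat 1) K) - Q)"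
      if "S \<in> feasible_vertices R Cl Cu u x" for S
    proof -
      have "S \<in> (\<lambda>(A, B). hcat A B) ` feasible_systems R Cl Cu u x"
        unfolding hull using that by (rule hull_inc)
      then obtain A B where "(A, B) \<in> feasible_systems R Cl Cu u x" "S = hcat A B"
        by auto
      then show ?thesis
        using neg_def_Stein_dual[OF P Q(2) Q(1) stable] by (simp add: loop)
    qed
    then show "\<exists>(K :: real^'n^'m) P. transpose P = P \<and> pos_def P \<and>
        (\<forall>S \<in> feasible_vertices R Cl Cu u x.
          neg_def (transpose (S ** vcat (mat 1) K) ** P ** (S ** vcat (mat 1) K) - P))"
      using Q(2) by (auto simp: pos_def_def)
  next
    assume "\<exists>(K :: real^'n^'m) P. transpose P = P \<and> pos_def P \<and>
        (\<forall>S \<in> feasible_vertices R Cl Cu u x.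
          neg_def (transpose (S ** vcat (mat 1) K) ** P ** (S ** vcat (mat 1) K) - P))"
    then obtain K :: "real^'n^'m" and P where P: "pos_def P"
      and vert: "\<And>S. S \<in> feasible_vertices R Cl Cu u x \<Longrightarrow>
          neg_def (transpose (S ** vcat (mat 1) K) ** P ** (S ** vcat (mat 1) K) - P)"
      by blast
    obtain Q where Q: "Q ** P = mat 1" "pos_def Q"
      using pos_def_has_pos_def_inverse[OF P] by blast
    have "convex hull (feasible_vertices R Cl Cu u x)
        \<subseteq> {S. neg_def (transpose (S ** vcat (mat 1) K) ** P ** (S ** vcat (mat 1) K) - P)}"
      using vert by (intro hull_minimal convex_contracting_systems[OF P]) blast
    then have "neg_def (transpose (A + B ** K) ** P ** (A + B ** K) - P)"
      if "(A, B) \<in> feasible_systems R Cl Cu u x" for A B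
      unfolding hull [symmetric] using that by (auto simp: loop)
    then have "neg_def ((A + B ** K) ** Q ** transpose (A + B ** K) - Q)"
      if "(A, B) \<in> feasible_systems R Cl Cu u x" for A B
      using that neg_def_Stein_dual[OF P Q(2), of "transpose (A + B ** K)"] P Q(1)
      by (simp add: matrix_left_right_inverse)
    then show "informative_quadratic_stabilization R Cl Cu u x"
      unfolding informative_quadratic_stabilization_def using Q(2) by blast
  qed
qed

end
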